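(* Let $A$ be a nonempty finite set of positive integers, let $n\in\mathbb{N}$, and let $f_A^{I}$ and $f_A^{II}$ be the functions defined in the context. 1. If $W_A(n)=\mathrm{I}$, then Player I wins NIM with cash from the state $(n;f_A^{I}(n),\infty)$. 2. If $W_A(n)=\mathrm{II}$, then Player II wins NIM with cash from the state $(n;\infty,f_A^{II}(n))$.
   Context: $\mathbb{N}=\{0,1,2,\dots\}$. Let $A$ be a nonempty finite set of positive integers and $a_1=\min(A)$. NIM: there are $n$ stones on the board. Players I and II alternate, Player I first; on his turn a player removes $a$ stones for some $a\in A$ not exceeding the number of stones present. A player who cannot move (fewer than $a_1$ stones) loses. $W_A(n)\in\{\mathrm{I},\mathrm{II}\}$ is the player with a winning strategy. NIM with cash, state $(n;d,e)$: $n$ stones are on the board, the player to move (called Player I) has $d$ dollars and the other player (Player II) has $e$ dollars. Players alternate, Player I first. A player removing $a\in A$ stones also loses $a$ dollars, so $a$ may exceed neither the number of stones nor the mover's dollars. A player who cannot move (fewer than $a_1$ stones, or he has fewer than $a_1$ dollars) loses. The value $\infty$ in place of $d$ or $e$ means that player has unlimited funds. "A player wins" a state means he has a winning strategy from it. The functions (defined by simultaneous recursion on $n$): $f_A^{I}(n)$ is defined when $W_A(n)=\mathrm{I}$ and $f_A^{II}(n)$ is defined when $W_A(n)=\mathrm{II}$. - If $0\le n\le a_1-1$: $f_A^{II}(n)=0$. - If $W_A(n)=\mathrm{I}$: $f_A^{I}(n)=\min\{f_A^{II}(n-a)+a : a\in A,\ a\le n,\ W_A(n-a)=\mathrm{II}\}$.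 - If $n\ge a_1$ and $W_A(n)=\mathrm{II}$: $f_A^{II}(n)=\max\{f_A^{I}(n-a): a\in A,\ a\le n\}$. *)

theory Defs
  imports Main "HOL-Library.Extended_Nat"
begin

datatype player = PlayerI | PlayerII

text \<open>
  A game is a relation \<open>mv\<close> between positions. The players alternate, Player I moving first from
  the starting position, and a player who cannot move loses. Plays are recorded as the nonempty
  list of positions visited so far, in chronological order, so it is Player I's turn after an
  odd number of positions. A strategy maps such a history to the next position.
\<close>

definition play :: "('s \<Rightarrow> 's \<Rightarrow> bool) \<Rightarrow> 's \<Rightarrow> 's list \<Rightarrow> bool" where
  "play mv s p \<longleftrightarrow> p \<noteq> [] \<and> hd p = s \<and> successively mv p"

definition to_move :: "'s list \<Rightarrow> player" where
  "to_move p = (if odd (length p) then PlayerI else PlayerII)"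

definition strategy :: "('s \<Rightarrow> 's \<Rightarrow> bool) \<Rightarrow> 's \<Rightarrow> player \<Rightarrow> ('s list \<Rightarrow> 's) \<Rightarrow> bool" where
  "strategy mv s P \<sigma> \<longleftrightarrow>
     (\<forall>p. play mv s p \<and> to_move p = P \<and> (\<exists>t. mv (last p) t) \<longrightarrow> mv (last p) (\<sigma> p))"

definition follows :: "player \<Rightarrow> ('s list \<Rightarrow> 's) \<Rightarrow> 's list \<Rightarrow> bool" where
  "follows P \<sigma> p \<longleftrightarrow>
     (\<forall>k. 0 < k \<and> k < length p \<and> to_move (take k p) = P \<longrightarrow> p ! k = \<sigma> (take k p))"

text \<open>
  Only finite plays are considered. Both games below remove a positive number of stones in every
  move, so they have no infinite plays.
\<close>

definition winning_strategy :: "('s \<Rightarrow> 's \<Rightarrow> bool) \<Rightarrow> 's \<Rightarrow> player \<Rightarrow> ('s list \<Rightarrow> 's) \<Rightarrow> bool" where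
  "winning_strategy mv s P \<sigma> \<longleftrightarrow> strategy mv s P \<sigma> \<and>
     (\<forall>p. play mv s p \<and> follows P \<sigma> p \<and> (\<nexists>t. mv (last p) t) \<longrightarrow> to_move p \<noteq> P)"

definition wins :: "('s \<Rightarrow> 's \<Rightarrow> bool) \<Rightarrow> 's \<Rightarrow> player \<Rightarrow> bool" where
  "wins mv s P \<longleftrightarrow> (\<exists>\<sigma>. winning_strategy mv s P \<sigma>)"

definition nim_move :: "nat set \<Rightarrow> nat \<Rightarrow> nat \<Rightarrow> bool" where
  "nim_move A n n' \<longleftrightarrow> (\<exists>a\<in>A. a \<le> n \<and> n' = n - a)"

definition W :: "nat set \<Rightarrow> nat \<Rightarrow> player" where
  "W A n = (THE P. wins (nim_move A) n P)"

text \<open>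
  In a position \<open>(n, d, e)\<close> of NIM with cash, \<open>d\<close> always belongs to the player about to move and
  \<open>e\<close> to the other one, so the two amounts are swapped by a move. On extended naturals
  \<open>\<infinity> - enat a = \<infinity>\<close>.
\<close>

type_synonym cash_state = "nat \<times> enat \<times> enat"

definition cash_move :: "nat set \<Rightarrow> cash_state \<Rightarrow> cash_state \<Rightarrow> bool" where
  "cash_move A s s' \<longleftrightarrow> (\<exists>n d e. s = (n, d, e) \<and>
     (\<exists>a\<in>A. a \<le> n \<and> enat a \<le> d \<and> s' = (n - a, e, d - enat a)))"

text \<open>
  The condition \<open>0 < a\<close> is vacuous for sets of positive integers and makes the recursion
  terminate for arbitrary \<open>A\<close>. Outside their domains of definition the functions are
  \<open>undefined\<close>.
\<close>

function f_I :: "nat set \<Rightarrow> nat \<Rightarrow> nat" and f_II :: "nat set \<Rightarrow> nat \<Rightarrow> nat" where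
  "f_I A n =
     (if W A n = PlayerI
      then Min ((\<lambda>a. f_II A (n - a) + a) ` {a \<in> A. 0 < a \<and> a \<le> n \<and> W A (n - a) = PlayerII})
      else undefined)"
| "f_II A n =
     (if n < Min A then 0
      else if W A n = PlayerII
      then Max ((\<lambda>a. f_I A (n - a)) ` {a \<in> A. 0 < a \<and> a \<le> n})
      else undefined)"
  by pat_completeness auto
termination
  by (relation "measure (\<lambda>x. case x of Inl (A, n) \<Rightarrow> n | Inr (A, n) \<Rightarrow> n)") auto

text \<open>The defining equations loop as simplification rules.\<close>
declare f_I.simps [simp del] f_II.simps [simp del]

end

theory Submission imports Defs begin

text \<open>
  The proof exhibits an invariant. Call a cash position good for the mover if \<open>W A n = PlayerI\<close>
  and the mover owns at least \<open>f_I A n\<close>, and good for the opponent if \<open>W A n = PlayerII\<close> and the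
  opponent owns at least \<open>f_II A n\<close>; the funds of the other side are arbitrary. From a position
  good for the mover, an \<open>a\<close> attaining the minimum that defines \<open>f_I A n\<close> is affordable and leaves at least
  \<open>f_II A (n - a)\<close> dollars, so the new position is good for the player who has just moved. From a
  position good for the opponent, every move leads to a position good for the new mover, because
  \<open>f_II A n\<close> is a maximum over all legal \<open>a\<close>. Hence the favoured player can keep the
  position good for himself throughout the play, and whenever he is to move in such a position he
  has a move: he is never the one who is stuck. Lemma \<open>wins_by_invariant\<close> turns such an invariant into a
  winning strategy.

  The argument uses the recursive description of \<open>W\<close>: Player I wins NIM exactly if some move
  reaches a position in which Player II wins. Since \<open>W\<close> is defined from strategies on histories by
  a definite description, this amounts to Zermelo's theorem for games without infinite plays:
  exactly one of the players has a winning strategy, and who it is can be read off the recursive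
  classification \<open>mover_wins\<close> of positions.
\<close>

section \<open>Strategies from invariants\<close>

lemma play_snoc:
  "play mv s (p @ [t]) \<longleftrightarrow> (if p = [] then t = s else play mv s p \<and> mv (last p) t)"
  by (auto simp: play_def successively_append_iff)

lemma to_move_snoc:
  "to_move (p @ [t]) = P \<longleftrightarrow> to_move p \<noteq> P"
  by (cases P) (auto simp: to_move_def)

lemma follows_snoc:
  assumes "p \<noteq> []"
  shows "follows P \<sigma> (p @ [t]) \<longleftrightarrow> follows P \<sigma> p \<and> (to_move p = P \<longrightarrow> t = \<sigma> p)"
  using assms unfolding follows_def
  by (auto simp: nth_append less_Suc_eq)

lemma follows_singleton: "follows P \<sigma> [s]"
  by (simp add: follows_def)

text \<open>
  Playing so as to enter \<open>Lose\<close> whenever possible keeps the favoured player in \<open>Win\<close> on his own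
  turns and the other one in \<open>Lose\<close>. A position in \<open>Win\<close> has a successor, so he is never stuck.
\<close>

lemma wins_by_invariant:
  fixes mv :: "'s \<Rightarrow> 's \<Rightarrow> bool"
  assumes Win: "\<And>s. Win s \<Longrightarrow> \<exists>t. mv s t \<and> Lose t"
    and Lose: "\<And>s t. Lose s \<Longrightarrow> mv s t \<Longrightarrow> Win t"
    and start: "if P = PlayerI then Win s else Lose s"
  shows "wins mv s P"
proof -
  \<comment> \<open>A strategy must be legal after every play, also after one that has left the invariant.\<close>
  define \<sigma> where "\<sigma> p = (if \<exists>t. mv (last p) t \<and> Lose t then SOME t. mv (last p) t \<and> Lose t
                        else SOME t. mv (last p) t)" for p :: "'s list"
  have \<sigma>_good: "mv (last p) (\<sigma> p) \<and> Lose (\<sigma> p)" if "Win (last p)" for p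
    using someI_ex[OF Win[OF that]] Win[OF that] by (simp add: \<sigma>_def)
  have \<sigma>_legal: "mv (last p) (\<sigma> p)" if "\<exists>t. mv (last p) t" for p
    using \<sigma>_good[of p] someI_ex[OF that] someI_ex[of "\<lambda>t. mv (last p) t \<and> Lose t"]
    by (auto simp: \<sigma>_def)
  have inv: "if to_move p = P then Win (last p) else Lose (last p)"
    if "play mv s p" "follows P \<sigma> p" for p
    using that
  proof (induction p rule: rev_induct)
    case Nil
    then show ?case by (simp add: play_def)
  next
    case (snoc t p)
    show ?case
    proof (cases "p = []")
      case True
      with snoc.prems have "t = s" by (simp add: play_def)
      with True start show ?thesis by (cases P) (simp_all add: to_move_def)
    next
      case False
      have p: "play mv s p" "mv (last p) t" "follows P \<sigma> p" "to_move p = P \<longrightarrow> t = \<sigma> p"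
        using snoc.prems False by (simp_all add: play_snoc follows_snoc)
      show ?thesis
        using snoc.IH[OF p(1,3)] p(2,4) \<sigma>_good[of p] Lose[of "last p" t]
        by (cases "to_move p = P") (simp_all add: to_move_snoc)
    qed
  qed
  have "winning_strategy mv s P \<sigma>"
    unfolding winning_strategy_def strategy_def
  proof (intro conjI allI impI)
    fix p
    assume "play mv s p \<and> to_move p = P \<and> (\<exists>t. mv (last p) t)"
    then show "mv (last p) (\<sigma> p)" using \<sigma>_legal by blast
  next
    fix p
    assume p: "play mv s p \<and> follows P \<sigma> p \<and> (\<nexists>t. mv (last p) t)"
    then have "\<not> Win (last p)" using Win by blast
    then show "to_move p \<noteq> P" using inv[of p] p by auto
  qed
  then show ?thesis unfolding wins_def by blast
qed

section \<open>Determinacy of games without infinite plays\<close>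

text \<open>
  If both players had winning strategies, any play following both could be prolonged: a play that
  is stuck would be lost by the player to move, and he is one of the two.
\<close>

lemma wins_exclusive:
  fixes mv :: "'s \<Rightarrow> 's \<Rightarrow> bool"
  assumes wf: "wfp (\<lambda>t s. mv s t)"
    and I: "wins mv s PlayerI" and II: "wins mv s PlayerII"
  shows False
proof -
  obtain \<sigma> \<tau> where \<sigma>: "winning_strategy mv s PlayerI \<sigma>" and \<tau>: "winning_strategy mv s PlayerII \<tau>"
    using I II unfolding wins_def by blast
  have "\<not> (play mv s p \<and> follows PlayerI \<sigma> p \<and> follows PlayerII \<tau> p)" if "last p = x" for p x
    using wf that
  proof (induction x arbitrary: p rule: wfp_induct_rule)
    case (less x)
    show ?case
    proof
      assume p: "play mv s p \<and> follows PlayerI \<sigma> p \<and> follows PlayerII \<tau> p"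
      then have ne: "p \<noteq> []" by (simp add: play_def)
      have moves: "\<exists>t. mv (last p) t"
        using \<sigma> \<tau> p unfolding winning_strategy_def by (cases "to_move p") blast+
      define t where "t = (if to_move p = PlayerI then \<sigma> p else \<tau> p)"
      have "mv (last p) t"
        using moves \<sigma> \<tau> p
        by (cases "to_move p") (auto simp: t_def winning_strategy_def strategy_def)
      moreover from this have "play mv s (p @ [t])"
        using p ne by (simp add: play_snoc)
      moreover have "follows PlayerI \<sigma> (p @ [t])" "follows PlayerII \<tau> (p @ [t])"
        using p ne by (simp_all add: follows_snoc t_def)
      ultimately show False
        using less.IH[of t "p @ [t]"] less.prems by simp
    qed
  qed
  from this[of "[s]" s] show False
    by (simp add: play_def follows_singleton)
qed

text \<open>
  The inner premise \<open>\<forall>u. mv t u \<longrightarrow> mover_wins mv u\<close> stands for a position \<open>t\<close> that is lost for its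
  mover. Being positive, unlike \<open>\<not> mover_wins mv t\<close>, it allows an inductive definition for every
  relation \<open>mv\<close>.
\<close>

inductive mover_wins :: "('s \<Rightarrow> 's \<Rightarrow> bool) \<Rightarrow> 's \<Rightarrow> bool" for mv where
  "mv s t \<Longrightarrow> (\<And>u. mv t u \<Longrightarrow> mover_wins mv u) \<Longrightarrow> mover_wins mv s"

text \<open>
  Well-foundedness rules out drawn positions, in which each side can avoid losing only by playing
  for ever. Hence every position that is not won for its mover is lost for him.
\<close>

lemma not_mover_wins_iff:
  assumes "wfp (\<lambda>t s. mv s t)"
  shows "\<not> mover_wins mv s \<longleftrightarrow> (\<forall>t. mv s t \<longrightarrow> mover_wins mv t)"
  using assms
proof (induction s rule: wfp_induct_rule)
  case (less s)
  have "mover_wins mv s \<longleftrightarrow> (\<exists>t. mv s t \<and> (\<forall>u. mv t u \<longrightarrow> mover_wins mv u))"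
    by (subst mover_wins.simps) auto
  then show ?case using less.IH by blast
qed

lemma wins_iff_mover_wins:
  assumes wf: "wfp (\<lambda>t s. mv s t)"
  shows "wins mv s P \<longleftrightarrow> (P = PlayerI \<longleftrightarrow> mover_wins mv s)"
proof -
  have *: "wins mv s P" if "P = PlayerI \<longleftrightarrow> mover_wins mv s" for P
  proof (rule wins_by_invariant)
    show "\<exists>t. mv s t \<and> \<not> mover_wins mv t" if "mover_wins mv s" for s
      using not_mover_wins_iff[OF wf, of s] that by blast
    show "mover_wins mv t" if "\<not> mover_wins mv s" "mv s t" for s t
      using not_mover_wins_iff[OF wf, of s] that by blast
    show "if P = PlayerI then mover_wins mv s else \<not> mover_wins mv s"
      using that by simp
  qed
  show ?thesis
    using *[of PlayerI] *[of PlayerII] wins_exclusive[OF wf, of s] by (cases P) auto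
qed

section \<open>The winner of NIM\<close>

lemma wfp_nim_move:
  assumes "\<forall>a\<in>A. 0 < a"
  shows "wfp (\<lambda>n' n. nim_move A n n')"
proof (rule wfp_subset[OF wfp_on_less])
  show "(\<lambda>n' n. nim_move A n n') \<le> (<)"
    using assms by (fastforce simp: nim_move_def)
qed

lemma W_eq_PlayerI_iff_mover_wins:
  assumes "\<forall>a\<in>A. 0 < a"
  shows "W A n = PlayerI \<longleftrightarrow> mover_wins (nim_move A) n"
proof -
  have "wins (nim_move A) n P \<longleftrightarrow> P = (if mover_wins (nim_move A) n then PlayerI else PlayerII)"
    for P
    by (cases P) (auto simp: wins_iff_mover_wins[OF wfp_nim_move[OF assms]])
  then show ?thesis by (simp add: W_def)
qed

text \<open>
  After a move the names of the players change hands, since \<open>W\<close> calls whoever is to move Player I;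
  this is why \<open>PlayerI\<close> stands on the right. Terminal positions are covered vacuously.
\<close>

lemma W_eq_PlayerII_iff:
  assumes "\<forall>a\<in>A. 0 < a"
  shows "W A n = PlayerII \<longleftrightarrow> (\<forall>a\<in>A. a \<le> n \<longrightarrow> W A (n - a) = PlayerI)"
proof -
  have "W A n = PlayerII \<longleftrightarrow> \<not> mover_wins (nim_move A) n"
    using W_eq_PlayerI_iff_mover_wins[OF assms] by (metis player.distinct(1) player.exhaust)
  also have "\<dots> \<longleftrightarrow> (\<forall>m. nim_move A n m \<longrightarrow> W A m = PlayerI)"
    unfolding W_eq_PlayerI_iff_mover_wins[OF assms]
    by (rule not_mover_wins_iff[OF wfp_nim_move[OF assms]])
  finally show ?thesis by (auto simp: nim_move_def)
qed

section \<open>Sufficient funds\<close>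

lemma f_I_attained:
  assumes "finite A" and pos: "\<forall>a\<in>A. 0 < a" and I: "W A n = PlayerI"
  obtains a where "a \<in> A" "a \<le> n" "W A (n - a) = PlayerII" "f_I A n = f_II A (n - a) + a"
proof -
  let ?B = "{a \<in> A. 0 < a \<and> a \<le> n \<and> W A (n - a) = PlayerII}"
  have "W A n \<noteq> PlayerII" using I by simp
  then obtain a where "a \<in> A" "a \<le> n" "W A (n - a) \<noteq> PlayerI"
    using W_eq_PlayerII_iff[OF pos, of n] by blast
  with pos have "a \<in> ?B" by (cases "W A (n - a)") auto
  then have "?B \<noteq> {}" by blast
  moreover have "finite ?B" using \<open>finite A\<close> by simp
  ultimately have "Min ((\<lambda>a. f_II A (n - a) + a) ` ?B) \<in> (\<lambda>a. f_II A (n - a) + a) ` ?B"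
    by (intro Min_in) auto
  then have "f_I A n \<in> (\<lambda>a. f_II A (n - a) + a) ` ?B"
    using I by (subst f_I.simps) simp
  then show thesis using that by auto
qed

lemma f_I_le_f_II:
  assumes "finite A" "\<forall>a\<in>A. 0 < a" "W A n = PlayerII" "a \<in> A" "a \<le> n"
  shows "f_I A (n - a) \<le> f_II A n"
proof -
  let ?B = "{a \<in> A. 0 < a \<and> a \<le> n}"
  \<comment> \<open>A legal move exists, so the defining equation is in its recursive case.\<close>
  have "\<not> n < Min A"
    using assms(1,4,5) Min_le[of A a] by linarith
  then have "f_II A n = Max ((\<lambda>a. f_I A (n - a)) ` ?B)"
    using assms(3) by (subst f_II.simps) simp
  moreover have "f_I A (n - a) \<le> Max ((\<lambda>a. f_I A (n - a)) ` ?B)"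
    using assms by (intro Max_ge) auto
  ultimately show ?thesis by simp
qed

text \<open>
  One invariant seen from two sides: a move exchanges the two amounts of money in the position, so
  the favoured player finds his own funds first on his turns and second on the other turns.
\<close>

definition mover_solvent :: "nat set \<Rightarrow> cash_state \<Rightarrow> bool" where
  "mover_solvent A = (\<lambda>(n, d, e). W A n = PlayerI \<and> enat (f_I A n) \<le> d)"

definition opponent_solvent :: "nat set \<Rightarrow> cash_state \<Rightarrow> bool" where
  "opponent_solvent A = (\<lambda>(n, d, e). W A n = PlayerII \<and> enat (f_II A n) \<le> e)"

lemma mover_solvent_move:
  assumes "finite A" "\<forall>a\<in>A. 0 < a" "mover_solvent A s"
  shows "\<exists>t. cash_move A s t \<and> opponent_solvent A t"
proof -
  obtain n d e where s: "s = (n, d, e)" by (cases s)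
  with assms(3) have n: "W A n = PlayerI" and d: "enat (f_I A n) \<le> d"
    by (simp_all add: mover_solvent_def)
  obtain a where a: "a \<in> A" "a \<le> n" "W A (n - a) = PlayerII" "f_I A n = f_II A (n - a) + a"
    using f_I_attained[OF assms(1,2) n] .
  have "enat a \<le> d" "enat (f_II A (n - a)) \<le> d - enat a"
    using d a(4) by (cases d; simp)+
  with a s have "cash_move A s (n - a, e, d - enat a)" "opponent_solvent A (n - a, e, d - enat a)"
    by (auto simp: cash_move_def opponent_solvent_def)
  then show ?thesis by blast
qed

lemma opponent_solvent_move:
  assumes "finite A" "\<forall>a\<in>A. 0 < a" "opponent_solvent A s" "cash_move A s t"
  shows "mover_solvent A t"
proof -
  from assms(3,4) obtain n d e a where n: "W A n = PlayerII" and e: "enat (f_II A n) \<le> e"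
    and a: "a \<in> A" "a \<le> n" and t: "t = (n - a, e, d - enat a)"
    by (auto simp: cash_move_def opponent_solvent_def)
  have "W A (n - a) = PlayerI"
    using W_eq_PlayerII_iff[OF assms(2)] n a by blast
  moreover have "enat (f_I A (n - a)) \<le> e"
    using f_I_le_f_II[OF assms(1,2) n a] e by (meson enat_ord_simps(1) order_trans)
  ultimately show ?thesis by (simp add: mover_solvent_def t)
qed

theorem theorem2p2:
  fixes A :: "nat set" and n :: nat
  assumes "finite A" and "A \<noteq> {}" and "\<forall>a\<in>A. 0 < a"
  shows "(W A n = PlayerI \<longrightarrow> wins (cash_move A) (n, enat (f_I A n), \<infinity>) PlayerI) \<and>
         (W A n = PlayerII \<longrightarrow> wins (cash_move A) (n, \<infinity>, enat (f_II A n)) PlayerII)"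
proof -
  have *: "wins (cash_move A) s P"
    if "if P = PlayerI then mover_solvent A s else opponent_solvent A s" for s P
    using mover_solvent_move[OF assms(1,3)] opponent_solvent_move[OF assms(1,3)] that
    by (rule wins_by_invariant)
  show ?thesis
    by (intro conjI impI *) (simp_all add: mover_solvent_def opponent_solvent_def)
qed

end
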